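(* Let $S$ be a subsemigroup of $((0,\infty),+)$ which is dense in $(0,\infty)$ and such that $cS=\{cs:s\in S\}$ is central$^*$ near zero for each $c\in\mathbb N$. Let $A$ be a subtracted centrally image partition regular matrix near zero over $S$. Then $A$ is centrally image partition regular near zero over $S$.
   Context: $\beta S$ is the set of ultrafilters on $S$, with addition extended by: $B\in p+q$ iff $\{x\in S:-x+B\in q\}\in p$ ($-x+B=\{y\in S:x+y\in B\}$). $O^+(S)=\{p\in\beta S:(0,\varepsilon)\cap S\in p$ for all $\varepsilon>0\}$ is a compact right topological semigroup; $K(O^+(S))$ is its smallest ideal. $C\subseteq S$ is central near zero if $C\in p$ for some idempotent $p\in K(O^+(S))$; a set is central$^*$ near zero if it belongs to every idempotent of $K(O^+(S))$. An $\omega\times\omega$ rational matrix $M$ is centrally image partition regular near zero over $S$ if whenever $C$ is central near zero in $S$ there is $\vec x\in S^\omega$ with $M\vec x\in C^\omega$. An $\omega\times\omega$ rational matrix $A$ is subtracted centrally image partition regular near zero over $S$ if no row of $A$ is $\vec 0$, each row has finitely many nonzero entries, and there exist $v\in\mathbb N$, an $\omega\times v$ matrix $A_1$ and an $\omega\times\omega$ matrix $A_2$ with $A=(A_1\ A_2)$, every row of $A_1$ a row of some fixed finite image partition regular matrix $D$, and $A_2$ centrally image partition regular near zero over $S$. A finite $u\times v$ rational matrix $D$ is image partition regular if it has no zero row and whenever $\mathbb N$ is finitely colored there is $\vec x\in\mathbb N^v$ with all entries of $D\vec x$ of the same color. *)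

theory Defs
  imports "HOL-Analysis.Elementary_Topology" "Jordan_Normal_Form.Matrix"
begin

section \<open>Ultrafilters on a subsemigroup of the positive reals\<close>

text \<open>An ultrafilter on \<open>S\<close> is represented literally as a family of subsets of \<open>S\<close>.\<close>

definition ultrafilters :: "real set \<Rightarrow> real set set set" where
  "ultrafilters S = {p. p \<subseteq> Pow S \<and> S \<in> p \<and> {} \<notin> p
     \<and> (\<forall>A\<in>p. \<forall>B\<in>p. A \<inter> B \<in> p)
     \<and> (\<forall>A\<in>p. \<forall>B. A \<subseteq> B \<and> B \<subseteq> S \<longrightarrow> B \<in> p)
     \<and> (\<forall>A. A \<subseteq> S \<longrightarrow> A \<in> p \<or> S - A \<in> p)}"

definition shift_back :: "real set \<Rightarrow> real \<Rightarrow> real set \<Rightarrow> real set" where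
  "shift_back S x B = {y \<in> S. x + y \<in> B}"

definition uf_add :: "real set \<Rightarrow> real set set \<Rightarrow> real set set \<Rightarrow> real set set" where
  "uf_add S p q = {B. B \<subseteq> S \<and> {x \<in> S. shift_back S x B \<in> q} \<in> p}"

definition O_plus :: "real set \<Rightarrow> real set set set" where
  "O_plus S = {p \<in> ultrafilters S. \<forall>\<epsilon>>0. {0<..<\<epsilon>} \<inter> S \<in> p}"

definition O_plus_ideal :: "real set \<Rightarrow> real set set set \<Rightarrow> bool" where
  "O_plus_ideal S I \<longleftrightarrow> I \<noteq> {} \<and> I \<subseteq> O_plus S
     \<and> (\<forall>p\<in>O_plus S. \<forall>q\<in>I. uf_add S p q \<in> I \<and> uf_add S q p \<in> I)"

text \<open>A compact right topological semigroup has a smallest two-sided ideal, so the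
  intersection of all (nonempty) two-sided ideals of \<open>O_plus S\<close> is that ideal.\<close>

definition K_O_plus :: "real set \<Rightarrow> real set set set" where
  "K_O_plus S = \<Inter> {I. O_plus_ideal S I}"

definition central_near_zero :: "real set \<Rightarrow> real set \<Rightarrow> bool" where
  "central_near_zero S C \<longleftrightarrow> C \<subseteq> S \<and> (\<exists>p\<in>K_O_plus S. uf_add S p p = p \<and> C \<in> p)"

definition central_star_near_zero :: "real set \<Rightarrow> real set \<Rightarrow> bool" where
  "central_star_near_zero S C \<longleftrightarrow> (\<forall>p\<in>K_O_plus S. uf_add S p p = p \<longrightarrow> C \<in> p)"

section \<open>Image partition regularity\<close>

text \<open>The positive naturals are coloured; only the values of the colouring \<open>\<phi>\<close> on
  \<open>{0<..}\<close> matter. The entries of the image are rational numbers that are required to be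
  positive naturals of one colour.\<close>

definition image_partition_regular :: "rat mat \<Rightarrow> bool" where
  "image_partition_regular D \<longleftrightarrow>
     (\<forall>i<dim_row D. row D i \<noteq> 0\<^sub>v (dim_col D))
     \<and> (\<forall>\<phi>::nat \<Rightarrow> nat. finite (\<phi> ` {0<..}) \<longrightarrow>
          (\<exists>x \<in> carrier_vec (dim_col D). \<exists>c. (\<forall>j<dim_col D. 0 < x $ j)
             \<and> (\<forall>i<dim_row D. \<exists>n>0. (D *\<^sub>v map_vec of_nat x) $ i = of_nat n \<and> \<phi> n = c)))"

text \<open>An \<open>\<omega> \<times> \<omega>\<close> rational matrix is a function \<open>nat \<Rightarrow> nat \<Rightarrow> rat\<close>. The product with a
  vector is meaningful for rows with finitely many nonzero entries; for any other row the
  sum below is \<open>0\<close>, which lies in no subset of \<open>(0,\<infinity>)\<close>.\<close>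

definition inf_mat_vec :: "(nat \<Rightarrow> nat \<Rightarrow> rat) \<Rightarrow> (nat \<Rightarrow> real) \<Rightarrow> nat \<Rightarrow> real" where
  "inf_mat_vec M x i = (\<Sum>j | M i j \<noteq> 0. of_rat (M i j) * x j)"

definition centrally_ipr_near_zero :: "real set \<Rightarrow> (nat \<Rightarrow> nat \<Rightarrow> rat) \<Rightarrow> bool" where
  "centrally_ipr_near_zero S M \<longleftrightarrow>
     (\<forall>C. central_near_zero S C \<longrightarrow>
        (\<exists>x. (\<forall>j. x j \<in> S) \<and> (\<forall>i. inf_mat_vec M x i \<in> C)))"

text \<open>The block matrix \<open>(A1 A2)\<close>, where \<open>A1\<close> has \<open>v\<close> columns and is given by its rows.\<close>

definition append_cols :: "nat \<Rightarrow> (nat \<Rightarrow> rat vec) \<Rightarrow> (nat \<Rightarrow> nat \<Rightarrow> rat) \<Rightarrow> nat \<Rightarrow> nat \<Rightarrow> rat" where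
  "append_cols v A1 A2 i j = (if j < v then A1 i $ j else A2 i (j - v))"

definition subtracted_centrally_ipr_near_zero :: "real set \<Rightarrow> (nat \<Rightarrow> nat \<Rightarrow> rat) \<Rightarrow> bool" where
  "subtracted_centrally_ipr_near_zero S A \<longleftrightarrow>
     (\<forall>i. \<exists>j. A i j \<noteq> 0)
     \<and> (\<forall>i. finite {j. A i j \<noteq> 0})
     \<and> (\<exists>v>0. \<exists>A1 A2 D.
          (\<forall>i. A1 i \<in> carrier_vec v)
          \<and> A = append_cols v A1 A2
          \<and> image_partition_regular D
          \<and> (\<forall>i. A1 i \<in> set (rows D))
          \<and> centrally_ipr_near_zero S A2)"

end

theory Submission
  imports Defs "HOL-Analysis.Function_Topology" "HOL-Library.Function_Algebras"
begin

text \<open>Let \<open>p\<close> be an idempotent of \<open>K(O\<^sup>+(S))\<close> containing \<open>C\<close>. Then \<open>{x \<in> S. -x + C \<in> p}\<close> is again in \<open>p\<close>, so it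
  contains all entries of \<open>D x\<close> for some \<open>x\<close>. The finite intersection of the sets \<open>-(D x)\<^sub>i + C\<close> is in
  \<open>p\<close>, hence central, and contains all entries of some \<open>A2 y\<close>; the vector \<open>(x, y)\<close> is as required.

  It remains to see that \<open>D\<close> has images in every member of \<open>p\<close>. Colouring \<open>\<nat>\<close> by \<open>ln y\<close> modulo
  \<open>n\<close> for larger and larger \<open>n\<close>, one finds a nonnegative rational matrix \<open>W\<close> such that \<open>D W\<close> is a
  first entries matrix with all first entries equal to 1. For such a matrix one builds, column by
  column, an ultrafilter on vectors whose image under every row is \<open>p\<close>; here the minimality of
  \<open>p\<close> among idempotents replaces the central sets theorem.\<close>

section \<open>Compact right topological semigroups\<close>

text \<open>Zorn's lemma for reverse inclusion, run on complements so that chains are bounded by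
  unions. The intersection of a chain of nonempty compact sets is nonempty by the finite
  intersection property.\<close>

lemma minimal_compact_subset:
  fixes X :: "'a::t2_space set"
  assumes "compact X" "X \<noteq> {}" "P X"
    and chain: "\<And>\<C>. \<C> \<noteq> {} \<Longrightarrow> (\<And>Y. Y \<in> \<C> \<Longrightarrow> compact Y \<and> Y \<noteq> {} \<and> P Y) \<Longrightarrow> P (\<Inter>\<C>)"
  obtains M where "M \<subseteq> X" "compact M" "M \<noteq> {}" "P M"
    "\<And>Y. Y \<subseteq> M \<Longrightarrow> compact Y \<Longrightarrow> Y \<noteq> {} \<Longrightarrow> P Y \<Longrightarrow> Y = M"
proof -
  define \<A> where "\<A> = {Y. Y \<subseteq> X \<and> compact Y \<and> Y \<noteq> {} \<and> P Y}"
  have "\<Union>\<C> \<in> uminus ` \<A>" if "\<C> \<noteq> {}" and ch: "subset.chain (uminus ` \<A>) \<C>" for \<C>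
  proof -
    define \<D> where "\<D> = uminus ` \<C>"
    have D: "\<D> \<noteq> {}" "\<D> \<subseteq> \<A>"
      using that unfolding \<D>_def subset.chain_def by auto
    have total: "Y \<subseteq> Z \<or> Z \<subseteq> Y" if "Y \<in> \<D>" "Z \<in> \<D>" for Y Z
      using that ch unfolding \<D>_def subset_chain_def by (metis (no_types, lifting) Compl_anti_mono imageE)
    obtain Z where Z: "Z \<in> \<D>" using D by auto
    have fin: "\<exists>Y\<in>\<D>. \<Inter>F = Y" if "finite F" "F \<noteq> {}" "F \<subseteq> \<D>" for F
      using that
    proof (induction F rule: finite_ne_induct)
      case (insert Y F)
      then obtain W where "W \<in> \<D>" "\<Inter>F = W" by auto
      then show ?case
        using total[of Y W] insert.prems by (auto simp: Int_absorb1 Int_absorb2)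
    qed auto
    have "Z \<inter> \<Inter>\<D> \<noteq> {}"
    proof (rule compact_imp_fip)
      fix F assume "finite F" "F \<subseteq> \<D>"
      then have "\<exists>Y\<in>\<D>. \<Inter>(insert Z F) = Y"
        using Z by (intro fin) auto
      then show "Z \<inter> \<Inter>F \<noteq> {}"
        using D unfolding \<A>_def by auto
    qed (use Z D in \<open>auto simp: \<A>_def intro: compact_imp_closed\<close>)
    then have ne: "\<Inter>\<D> \<noteq> {}" by auto
    have "closed (\<Inter>\<D>)"
      using D by (intro closed_Inter) (auto simp: \<A>_def compact_imp_closed)
    then have "compact (Z \<inter> \<Inter>\<D>)"
      using Z D by (auto simp: \<A>_def intro!: compact_Int_closed)
    moreover have "Z \<inter> \<Inter>\<D> = \<Inter>\<D>" using Z by auto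
    moreover have "P (\<Inter>\<D>)"
      using D by (intro chain) (auto simp: \<A>_def)
    moreover have "\<Inter>\<D> \<subseteq> X"
      using Z D unfolding \<A>_def by blast
    ultimately have "\<Inter>\<D> \<in> \<A>"
      using ne unfolding \<A>_def by simp
    moreover have "\<Union>\<C> = - \<Inter>\<D>"
      unfolding \<D>_def by auto
    ultimately show ?thesis by auto
  qed
  then have "\<exists>M\<in>uminus ` \<A>. \<forall>Y\<in>uminus ` \<A>. M \<subseteq> Y \<longrightarrow> Y = M"
    using assms by (intro subset_Zorn_nonempty) (auto simp: \<A>_def)
  then obtain M where M: "M \<in> \<A>" "\<And>Y. Y \<in> \<A> \<Longrightarrow> Y \<subseteq> M \<Longrightarrow> Y = M"
    by auto
  show ?thesis
    by (rule that[of M]) (use M in \<open>auto simp: \<A>_def\<close>)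
qed

locale right_topological_semigroup =
  fixes mult :: "'a::t2_space \<Rightarrow> 'a \<Rightarrow> 'a" (infixl \<open>\<star>\<close> 70)
  assumes assoc: "(x \<star> y) \<star> z = x \<star> (y \<star> z)"
    and continuous_mult: "continuous_on UNIV (\<lambda>x. x \<star> y)"
begin

lemma compact_translate: "compact M \<Longrightarrow> compact ((\<lambda>x. x \<star> y) ` M)"
  by (rule compact_continuous_image[OF continuous_on_subset[OF continuous_mult]]) auto

text \<open>Ellis-Numakura: take a minimal compact subsemigroup \<open>M\<close> and
  \<open>e\<close> in it. Minimality gives \<open>M \<star> e = M\<close>, so the elements
  \<open>x\<close> of \<open>M\<close> with \<open>x \<star> e = e\<close> form a nonempty compact
  subsemigroup, hence all of \<open>M\<close>, including \<open>e\<close>.\<close>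

lemma idempotent_exists:
  assumes "compact X" "X \<noteq> {}" "\<And>x y. x \<in> X \<Longrightarrow> y \<in> X \<Longrightarrow> x \<star> y \<in> X"
  obtains e where "e \<in> X" "e \<star> e = e"
proof -
  define P where "P = (\<lambda>Y. \<forall>x\<in>Y. \<forall>y\<in>Y. x \<star> y \<in> Y)"
  obtain M where M: "M \<subseteq> X" "compact M" "M \<noteq> {}" "P M"
    and min: "\<And>Y. Y \<subseteq> M \<Longrightarrow> compact Y \<Longrightarrow> Y \<noteq> {} \<Longrightarrow> P Y \<Longrightarrow> Y = M"
  proof (rule minimal_compact_subset[of X P])
    show "P X" using assms(3) by (auto simp: P_def)
    show "P (\<Inter>\<C>)" if "\<C> \<noteq> {}" "\<And>Y. Y \<in> \<C> \<Longrightarrow> compact Y \<and> Y \<noteq> {} \<and> P Y" for \<C>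
      using that(2) unfolding P_def by blast
  qed (use assms in auto)
  have mul: "x \<star> y \<in> M" if "x \<in> M" "y \<in> M" for x y
    using M that by (auto simp: P_def)
  obtain e where e: "e \<in> M" using M by auto
  have "(\<lambda>x. x \<star> e) ` M = M"
  proof (rule min)
    show "P ((\<lambda>x. x \<star> e) ` M)"
      unfolding P_def
    proof (intro ballI)
      fix x y assume "x \<in> (\<lambda>x. x \<star> e) ` M" "y \<in> (\<lambda>x. x \<star> e) ` M"
      then obtain a b where ab: "a \<in> M" "b \<in> M" "x = a \<star> e" "y = b \<star> e" by auto
      then have "x \<star> y = (a \<star> (e \<star> b)) \<star> e" by (simp add: assoc)
      then show "x \<star> y \<in> (\<lambda>x. x \<star> e) ` M" using ab e mul by auto
    qed
  qed (use M e mul in \<open>auto intro: compact_translate\<close>)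
  then obtain x where x: "x \<in> M" "x \<star> e = e"
    using e by (metis (no_types, lifting) imageE)
  let ?N = "M \<inter> (\<lambda>x. x \<star> e) -` {e}"
  have "?N = M"
  proof (rule min)
    have "closed ((\<lambda>x. x \<star> e) -` {e})"
      by (rule continuous_closed_vimage[OF closed_singleton])
        (use continuous_mult in \<open>auto simp: continuous_on_eq_continuous_at\<close>)
    then show "compact ?N"
      by (intro compact_Int_closed M)
    show "?N \<noteq> {}" using x by auto
    show "P ?N" unfolding P_def using mul by (auto simp: assoc)
  qed auto
  then have "e \<star> e = e" using e by auto
  then show ?thesis using that e M by auto
qed

section \<open>Minimal left ideals\<close>

definition left_ideal :: "'a set \<Rightarrow> 'a set \<Rightarrow> bool" where
  "left_ideal X L \<longleftrightarrow> L \<noteq> {} \<and> L \<subseteq> X \<and> (\<forall>x\<in>X. \<forall>y\<in>L. x \<star> y \<in> L)"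

definition minimal_left_ideal :: "'a set \<Rightarrow> 'a set \<Rightarrow> bool" where
  "minimal_left_ideal X L \<longleftrightarrow> left_ideal X L \<and> (\<forall>L'. left_ideal X L' \<and> L' \<subseteq> L \<longrightarrow> L' = L)"

text \<open>Minimality among compact invariant sets suffices: for any \<open>y\<close> in a left
  ideal, the products \<open>x \<star> y\<close> with \<open>x \<in> X\<close> form a compact left
  ideal inside it.\<close>

lemma minimal_left_ideal_exists:
  assumes "compact X" "X \<noteq> {}" and mul: "\<And>x y. x \<in> X \<Longrightarrow> y \<in> X \<Longrightarrow> x \<star> y \<in> X"
  obtains L where "minimal_left_ideal X L"
proof -
  define P where "P = (\<lambda>Y. \<forall>x\<in>X. \<forall>y\<in>Y. x \<star> y \<in> Y)"
  obtain M where M: "M \<subseteq> X" "compact M" "M \<noteq> {}" "P M"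
    and min: "\<And>Y. Y \<subseteq> M \<Longrightarrow> compact Y \<Longrightarrow> Y \<noteq> {} \<Longrightarrow> P Y \<Longrightarrow> Y = M"
  proof (rule minimal_compact_subset[of X P])
    show "P X" using mul by (auto simp: P_def)
    show "P (\<Inter>\<C>)" if "\<C> \<noteq> {}" "\<And>Y. Y \<in> \<C> \<Longrightarrow> compact Y \<and> Y \<noteq> {} \<and> P Y" for \<C>
      using that(2) unfolding P_def by blast
  qed (use assms in auto)
  have "L' = M" if L': "left_ideal X L'" "L' \<subseteq> M" for L'
  proof -
    obtain y where y: "y \<in> L'" using L' by (auto simp: left_ideal_def)
    have sub: "(\<lambda>x. x \<star> y) ` X \<subseteq> L'"
      using L' y by (auto simp: left_ideal_def)
    have "(\<lambda>x. x \<star> y) ` X = M"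
    proof (rule min)
      show "P ((\<lambda>x. x \<star> y) ` X)"
        unfolding P_def using mul by (auto simp flip: assoc)
    qed (use assms sub L' in \<open>auto intro: compact_translate\<close>)
    then show ?thesis using sub L' by auto
  qed
  then show ?thesis
    using M by (intro that[of M]) (auto simp: minimal_left_ideal_def left_ideal_def P_def)
qed

text \<open>A left ideal inside the translate pulls back to one inside \<open>L\<close>, which must
  be \<open>L\<close> itself.\<close>

lemma minimal_left_ideal_translate:
  assumes L: "minimal_left_ideal X L" and s: "s \<in> X"
    and mul: "\<And>x y. x \<in> X \<Longrightarrow> y \<in> X \<Longrightarrow> x \<star> y \<in> X"
  shows "minimal_left_ideal X ((\<lambda>x. x \<star> s) ` L)"
  unfolding minimal_left_ideal_def
proof (intro conjI allI impI)
  show "left_ideal X ((\<lambda>x. x \<star> s) ` L)"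
    using assms by (auto simp: minimal_left_ideal_def left_ideal_def simp flip: assoc)
  fix L' assume L': "left_ideal X L' \<and> L' \<subseteq> (\<lambda>x. x \<star> s) ` L"
  let ?J = "{x \<in> L. x \<star> s \<in> L'}"
  have "left_ideal X ?J"
    using L L' by (auto simp: minimal_left_ideal_def left_ideal_def assoc)
  then have "?J = L" using L by (auto simp: minimal_left_ideal_def)
  then show "L' = (\<lambda>x. x \<star> s) ` L" using L' by auto
qed

text \<open>\<open>f = f \<star> p\<close> lies in \<open>L\<close>, so by minimality
  \<open>L\<close> is the left ideal of all \<open>x \<star> f\<close>. Hence \<open>p\<close> is
  fixed by right multiplication with \<open>f\<close>, while \<open>p \<star> f = f\<close>.\<close>

lemma minimal_left_ideal_idempotent_minimal:
  assumes L: "minimal_left_ideal X L" and "p \<in> L" "f \<in> X"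
    and f: "f \<star> f = f" "f \<star> p = f" "p \<star> f = f"
    and mul: "\<And>x y. x \<in> X \<Longrightarrow> y \<in> X \<Longrightarrow> x \<star> y \<in> X"
  shows "f = p"
proof -
  have "f \<in> L"
    using assms by (metis left_ideal_def minimal_left_ideal_def)
  then have "left_ideal X ((\<lambda>x. x \<star> f) ` X)" "(\<lambda>x. x \<star> f) ` X \<subseteq> L"
    using L mul \<open>f \<in> X\<close> by (auto simp: minimal_left_ideal_def left_ideal_def simp flip: assoc)
  then have "p \<in> (\<lambda>x. x \<star> f) ` X"
    using L \<open>p \<in> L\<close> by (auto simp: minimal_left_ideal_def)
  then have "p \<star> f = p" using f by (auto simp: assoc)
  then show ?thesis using f by simp
qed

end

section \<open>Ultrafilters as Boolean homomorphisms\<close>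

text \<open>Ultrafilters will be points of a product of copies of \<open>bool\<close>; the semigroup
  arguments need this product to be Hausdorff.\<close>

instance "fun" :: (type, t2_space) t2_space
proof
  fix f g :: "'a \<Rightarrow> 'b" assume "f \<noteq> g"
  then obtain x where x: "f x \<noteq> g x" by auto
  obtain U V where UV: "open U" "open V" "f x \<in> U" "g x \<in> V" "U \<inter> V = {}"
    using hausdorff[OF x] by auto
  have "open ((\<lambda>h::'a \<Rightarrow> 'b. h x) -` W)" if "open W" for W
    by (rule open_vimage[OF that continuous_on_product_coordinates])
  then show "\<exists>U V. open U \<and> open V \<and> f \<in> U \<and> g \<in> V \<and> U \<inter> V = {}"
    using UV by (intro exI[of _ "(\<lambda>h. h x) -` U"] exI[of _ "(\<lambda>h. h x) -` V"]) auto
qed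

lemma compact_bool_functions: "compact (UNIV :: ('a \<Rightarrow> bool) set)"
proof -
  have "compact (UNIV :: bool set)"
    by (simp add: finite_imp_compact)
  then have "compact_space (euclidean :: bool topology)"
    by (simp add: compact_space_def)
  then have "compact_space (euclidean :: ('a \<Rightarrow> bool) topology)"
    by (simp add: compact_space_product_topology flip: euclidean_product_topology)
  then show ?thesis by (simp add: compact_space_def)
qed

text \<open>Ultrafilters as two-valued homomorphisms instead of families of sets: they then form a
  closed subset of a compact product space, with the usual topology of \<beta>X. Properness follows
  from the two clauses.\<close>

definition ultra :: "('a set \<Rightarrow> bool) \<Rightarrow> bool" where
  "ultra P \<longleftrightarrow> (\<forall>A B. P (A \<inter> B) \<longleftrightarrow> P A \<and> P B) \<and> (\<forall>A. P (- A) \<longleftrightarrow> \<not> P A)"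

text \<open>Defined for arbitrary predicates, so that associativity and continuity hold on the whole
  type; the subsemigroup enters later through \<open>near_zero\<close>.\<close>

definition uadd :: "('a::plus set \<Rightarrow> bool) \<Rightarrow> ('a set \<Rightarrow> bool) \<Rightarrow> 'a set \<Rightarrow> bool" where
  "uadd P Q B = P {x. Q {y. x + y \<in> B}}"

definition push :: "('a \<Rightarrow> 'b) \<Rightarrow> ('a set \<Rightarrow> bool) \<Rightarrow> 'b set \<Rightarrow> bool" where
  "push h P B = P (h -` B)"

lemma ultra_Int: "ultra P \<Longrightarrow> P (A \<inter> B) \<longleftrightarrow> P A \<and> P B"
  and ultra_Compl: "ultra P \<Longrightarrow> P (- A) \<longleftrightarrow> \<not> P A"
  by (auto simp: ultra_def)

lemma ultra_mono: "ultra P \<Longrightarrow> P A \<Longrightarrow> A \<subseteq> B \<Longrightarrow> P B"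
  by (metis ultra_Int inf.absorb1)

lemma ultra_empty: "ultra P \<Longrightarrow> \<not> P {}"
  by (metis ultra_Int ultra_Compl inf_compl_bot)

lemma ultra_UNIV: "ultra P \<Longrightarrow> P UNIV"
  by (metis ultra_empty ultra_Compl Compl_empty_eq)

lemma ultra_Collect_conj: "ultra P \<Longrightarrow> P {x. A x \<and> B x} \<longleftrightarrow> P {x. A x} \<and> P {x. B x}"
  by (simp add: Collect_conj_eq ultra_Int)

lemma ultra_Collect_ball:
  assumes "ultra P" "finite I" "\<And>i. i \<in> I \<Longrightarrow> P {x. A i x}"
  shows "P {x. \<forall>i\<in>I. A i x}"
  using assms(2,3)
  by (induction I rule: finite_induct) (auto simp: ultra_UNIV[OF assms(1)] ultra_Collect_conj[OF assms(1)])

lemma ultra_witness: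
  assumes "ultra P" "P {x. A x}"
  obtains x where "A x"
  using assms ultra_empty[of P] by (metis Collect_empty_eq)

lemma ultra_push: "ultra P \<Longrightarrow> ultra (push h P)"
  unfolding ultra_def push_def by (simp add: vimage_Int vimage_Compl)

lemma ultra_uadd:
  assumes "ultra P" "ultra Q"
  shows "ultra (uadd P Q)"
proof -
  have "{x. Q {y. x + y \<in> A \<inter> B}} = {x. Q {y. x + y \<in> A}} \<inter> {x. Q {y. x + y \<in> B}}" for A B
    using ultra_Int[OF assms(2), of "{y. x + y \<in> A}" "{y. x + y \<in> B}" for x]
    by (simp add: Int_def set_eq_iff)
  moreover have "{x. Q {y. x + y \<in> - A}} = - {x. Q {y. x + y \<in> A}}" for A
    using ultra_Compl[OF assms(2), of "{y. x + y \<in> A}" for x]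
    by (simp add: Compl_eq set_eq_iff)
  ultimately show ?thesis
    unfolding ultra_def uadd_def by (simp add: ultra_Int ultra_Compl assms)
qed

lemma push_uadd:
  assumes "\<And>x y. h (x + y) = h x + h y"
  shows "push h (uadd P Q) = uadd (push h P) (push h Q)"
  by (simp add: push_def uadd_def fun_eq_iff vimage_def assms)

lemma push_push: "push g (push h P) = push (g \<circ> h) P"
  by (simp add: push_def fun_eq_iff vimage_comp)

lemma push_id: "push (\<lambda>x. x) P = P"
  by (simp add: push_def fun_eq_iff)

lemma uadd_push_zero:
  fixes P Q :: "'a::monoid_add set \<Rightarrow> bool"
  assumes "ultra P"
  shows "uadd (push (\<lambda>_. 0) P) Q = Q" "uadd Q (push (\<lambda>_. 0) P) = Q"
  using ultra_empty[OF assms] ultra_UNIV[OF assms]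
  by (auto simp: push_def uadd_def fun_eq_iff vimage_def)

section \<open>Continuity and closedness in the space of ultrafilters\<close>

lemma continuous_push: "continuous_on UNIV (push h)"
proof (rule continuous_on_coordinatewise_then_product)
  show "continuous_on UNIV (\<lambda>P. push h P B)" for B
    unfolding push_def by (rule continuous_on_product_coordinates)
qed

lemma closed_holds: "closed {P :: 'a set \<Rightarrow> bool. P A}"
  and closed_not_holds: "closed {P :: 'a set \<Rightarrow> bool. \<not> P A}"
  using closed_Collect_eq[OF continuous_on_product_coordinates[of A] continuous_on_const[of UNIV True]]
    closed_Collect_eq[OF continuous_on_product_coordinates[of A] continuous_on_const[of UNIV False]]
  by simp_all

lemma closed_ultra: "closed {P. ultra P}"
proof -
  \<comment> \<open>Negations are driven down to single coordinates, where truth and falsity are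
    both closed conditions.\<close>
  have "ultra P \<longleftrightarrow> (\<forall>A B. (P (A \<inter> B) \<and> P A \<and> P B) \<or> (\<not> P (A \<inter> B) \<and> (\<not> P A \<or> \<not> P B)))
      \<and> (\<forall>A. (P (- A) \<and> \<not> P A) \<or> (\<not> P (- A) \<and> P A))" for P :: "'a set \<Rightarrow> bool"
    unfolding ultra_def by blast
  then show ?thesis
    by (simp only:) (intro closed_Collect_conj closed_Collect_all closed_Collect_disj closed_holds closed_not_holds)
qed

interpretation uadd: right_topological_semigroup "uadd :: ('a::semigroup_add set \<Rightarrow> bool) \<Rightarrow> _"
proof
  show "uadd (uadd P Q) R = uadd P (uadd Q R)" for P Q R :: "'a set \<Rightarrow> bool"
    by (rule ext) (simp only: uadd_def mem_Collect_eq add.assoc)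
  show "continuous_on UNIV (\<lambda>P. uadd P Q)" for Q :: "'a set \<Rightarrow> bool"
  proof (rule continuous_on_coordinatewise_then_product)
    show "continuous_on UNIV (\<lambda>P. uadd P Q B)" for B
      unfolding uadd_def by (rule continuous_on_product_coordinates)
  qed
qed

section \<open>The structure of finite image partition regular matrices\<close>

text \<open>The induction is Bartl's: if \<open>c0\<close> violates the hypothesis for the smaller family, project
  everything along \<open>a m\<close> so as to be orthogonal to \<open>c0\<close>.\<close>

lemma farkas:
  fixes a :: "'j \<Rightarrow> 'i \<Rightarrow> 'f::linordered_field"
  assumes I: "finite I" and "finite J"
    and "\<And>c. (\<And>j. j \<in> J \<Longrightarrow> (\<Sum>i\<in>I. c i * a j i) \<le> 0) \<Longrightarrow> (\<Sum>i\<in>I. c i * b i) \<le> 0"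
  shows "\<exists>l. (\<forall>j\<in>J. 0 \<le> l j) \<and> (\<forall>i\<in>I. b i = (\<Sum>j\<in>J. l j * a j i))"
  using \<open>finite J\<close> assms(3)
proof (induction J arbitrary: a b rule: finite_induct)
  case empty
  have "b i = 0" if "i \<in> I" for i
  proof -
    have "(\<Sum>k\<in>I. (if k = i then b i else 0) * b k) \<le> 0"
      by (rule empty.prems) auto
    also have "(\<Sum>k\<in>I. (if k = i then b i else 0) * b k) = b i * b i"
      using I that by (simp add: if_distrib[of "\<lambda>x. x * _"] sum.delta' cong: if_cong)
    finally show ?thesis by (metis mult_eq_0_iff order_antisym zero_le_square)
  qed
  then show ?case by auto
next
  case (insert m J)
  define pr where "pr c d = (\<Sum>i\<in>I. c i * d i)" for c d :: "'i \<Rightarrow> 'f"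
  have pr_diff: "pr c (\<lambda>i. d i - r * e i) = pr c d - r * pr c e"
    "pr (\<lambda>i. d i - r * e i) c = pr d c - r * pr e c" for c d e :: "'i \<Rightarrow> 'f" and r
    by (simp_all add: pr_def algebra_simps sum_subtractf sum_distrib_left)
  have dom: "pr c b \<le> 0" if "\<And>j. j \<in> insert m J \<Longrightarrow> pr c (a j) \<le> 0" for c
    using insert.prems[of c] that by (simp add: pr_def)
  show ?case
  proof (cases "\<forall>c. (\<forall>j\<in>J. pr c (a j) \<le> 0) \<longrightarrow> pr c b \<le> 0")
    case True
    then obtain l where l: "\<forall>j\<in>J. 0 \<le> l j" "\<forall>i\<in>I. b i = (\<Sum>j\<in>J. l j * a j i)"
      using insert.IH[of a b] by (auto simp: pr_def)
    have "(\<Sum>j\<in>J. (l(m := 0)) j * a j i) = (\<Sum>j\<in>J. l j * a j i)" for i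
      using insert.hyps by (intro sum.cong) auto
    then show ?thesis
      using l insert.hyps by (intro exI[of _ "l(m := 0)"]) auto
  next
    case False
    then obtain c0 where c0: "\<And>j. j \<in> J \<Longrightarrow> pr c0 (a j) \<le> 0" "pr c0 b > 0"
      by (auto simp: not_le)
    define s where "s = pr c0 (a m)"
    have s: "s > 0"
      using dom[of c0] c0 by (force simp: s_def)
    define a' where "a' j = (\<lambda>i. a j i - pr c0 (a j) / s * a m i)" for j
    define b' where "b' = (\<lambda>i. b i - pr c0 b / s * a m i)"
    have "pr c b' \<le> 0" if c: "\<And>j. j \<in> J \<Longrightarrow> pr c (a' j) \<le> 0" for c
    proof -
      \<comment> \<open>\<open>?c\<close> kills \<open>a m\<close>, and pairing it with
        \<open>d\<close> is pairing \<open>c\<close> with the projection of \<open>d\<close>; thus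
        the hypothesis on all of \<open>insert m J\<close> applies to \<open>?c\<close>.\<close>
      let ?c = "\<lambda>i. c i - pr c (a m) / s * c0 i"
      have eq: "pr ?c d = pr c (\<lambda>i. d i - pr c0 d / s * a m i)" for d
        unfolding pr_diff by simp
      have "pr ?c (a m) = 0"
        using s unfolding pr_diff s_def by simp
      then have "pr ?c b \<le> 0"
        using c by (intro dom) (auto simp only: eq a'_def insert_iff)
      then show ?thesis by (simp only: eq b'_def)
    qed
    then obtain l where l: "\<And>j. j \<in> J \<Longrightarrow> 0 \<le> l j" "\<And>i. i \<in> I \<Longrightarrow> b' i = (\<Sum>j\<in>J. l j * a' j i)"
      using insert.IH[of a' b'] by (auto simp: pr_def)
    \<comment> \<open>The coefficient of \<open>a m\<close> once the projections are undone; it is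
      nonnegative because \<open>c0\<close> is positive on \<open>b\<close> and nonpositive on each
      \<open>a j\<close> with \<open>j \<in> J\<close>.\<close>
    define t where "t = (pr c0 b - (\<Sum>j\<in>J. l j * pr c0 (a j))) / s"
    have "(\<Sum>j\<in>J. l j * pr c0 (a j)) \<le> 0"
      using l(1) c0(1) by (intro sum_nonpos) (simp add: mult_nonneg_nonpos)
    then have "t \<ge> 0"
      using c0(2) s by (simp add: t_def)
    moreover have "b i = (\<Sum>j\<in>insert m J. (l(m := t)) j * a j i)" if "i \<in> I" for i
    proof -
      have "b i = pr c0 b / s * a m i + (\<Sum>j\<in>J. l j * a' j i)"
        using l(2)[OF that] by (simp add: b'_def algebra_simps)
      also have "(\<Sum>j\<in>J. l j * a' j i)
          = (\<Sum>j\<in>J. l j * a j i) - (\<Sum>j\<in>J. l j * pr c0 (a j)) / s * a m i"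
        by (simp add: a'_def algebra_simps sum_subtractf sum_distrib_left sum_divide_distrib)
      also have "pr c0 b / s * a m i + \<dots> = t * a m i + (\<Sum>j\<in>J. l j * a j i)"
        by (simp add: t_def diff_divide_distrib algebra_simps)
      also have "(\<Sum>j\<in>J. l j * a j i) = (\<Sum>j\<in>J. (l(m := t)) j * a j i)"
        using insert.hyps by (intro sum.cong) auto
      finally show ?thesis using insert.hyps by simp
    qed
    ultimately show ?thesis
      using l(1) by (intro exI[of _ "l(m := t)"]) auto
  qed
qed

text \<open>The colour records \<open>ln y\<close> modulo \<open>n\<close> up to an error \<open>1 / n\<close>.\<close>

definition level_colour :: "nat \<Rightarrow> nat \<Rightarrow> nat" where
  "level_colour n y = nat \<lfloor>real n ^ 2 * frac (ln (real y) / real n)\<rfloor>"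

lemma finite_level_colour: "finite (level_colour n ` A)"
proof (rule finite_subset)
  have "real n ^ 2 * frac (ln (real y) / real n) \<le> real n ^ 2 * 1" for y
    by (intro mult_left_mono frac_lt_1[THEN less_imp_le]) auto
  then have "\<lfloor>real n ^ 2 * frac (ln (real y) / real n)\<rfloor> \<le> \<lfloor>real (n ^ 2)\<rfloor>" for y
    by (intro floor_mono) simp
  then have "level_colour n y \<le> n ^ 2" for y
    unfolding level_colour_def by (metis floor_of_nat nat_le_iff)
  then show "level_colour n ` A \<subseteq> {..n ^ 2}" by auto
qed simp

lemma level_colour_eqD:
  assumes "n > 0" "level_colour n y = level_colour n z"
  defines "k \<equiv> \<lambda>y. \<lfloor>ln (real y) / real n\<rfloor>"
  shows "\<bar>ln (real y) - ln (real z) - real n * (k y - k z)\<bar> \<le> 1 / real n"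
proof -
  define q where "q y = frac (ln (real y) / real n)" for y
  have ln_eq: "ln (real y) = real n * k y + real n * q y" for y
    using \<open>n > 0\<close> by (simp add: k_def q_def frac_def field_simps)
  have nonneg: "0 \<le> real n ^ 2 * q y" for y by (simp add: q_def)
  \<comment> \<open>Equal floors put the scaled fractional parts within distance 1. One factor
    \<open>n\<close> of \<open>n ^ 2\<close> rescales to the logarithm, the other is the
    precision.\<close>
  have "\<lfloor>real n ^ 2 * q y\<rfloor> = \<lfloor>real n ^ 2 * q z\<rfloor>"
    using assms(2) nonneg[of y] nonneg[of z] by (simp add: level_colour_def q_def eq_nat_nat_iff)
  then have "\<bar>real n ^ 2 * q y - real n ^ 2 * q z\<bar> < 1"
    by linarith
  moreover have "real n ^ 2 * q y - real n ^ 2 * q z = real n * (real n * q y - real n * q z)"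
    by (simp add: power2_eq_square algebra_simps)
  ultimately have "real n * \<bar>real n * q y - real n * q z\<bar> < 1"
    by (simp only: abs_mult abs_of_nat)
  then have "\<bar>real n * q y - real n * q z\<bar> \<le> 1 / real n"
    using \<open>n > 0\<close> by (simp add: field_simps)
  then show ?thesis
    unfolding ln_eq by (simp add: algebra_simps)
qed

text \<open>The difference of the logarithms is \<open>N n\<close> times an integer, up to
  \<open>1 / N n\<close>. If the integer is 0 the difference tends to 0; if it is negative the
  difference tends to minus infinity. Then exponentiate.\<close>

lemma ln_level_ratio_tendsto:
  fixes Y Z N :: "nat \<Rightarrow> nat"
  assumes pos: "\<And>n. Y n > 0" "\<And>n. Z n > 0" "\<And>n. N n > 0" and N: "filterlim N at_top at_top"
    and col: "\<And>n. level_colour (N n) (Y n) = level_colour (N n) (Z n)"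
  defines "k \<equiv> \<lambda>n y. \<lfloor>ln (real y) / real (N n)\<rfloor>"
  shows "(\<And>n. k n (Y n) = k n (Z n)) \<Longrightarrow> (\<lambda>n. real (Y n) / real (Z n)) \<longlonglongrightarrow> 1"
    and "(\<And>n. k n (Y n) < k n (Z n)) \<Longrightarrow> (\<lambda>n. real (Y n) / real (Z n)) \<longlonglongrightarrow> 0"
proof -
  define d where "d n = ln (real (Y n)) - ln (real (Z n))" for n
  have ratio: "real (Y n) / real (Z n) = exp (d n)" for n
    using pos by (simp add: d_def exp_diff)
  have d: "\<bar>d n - real (N n) * (k n (Y n) - k n (Z n))\<bar> \<le> 1 / real (N n)" for n
    unfolding d_def k_def by (rule level_colour_eqD) (use pos col in auto)
  have N': "filterlim (\<lambda>n. real (N n)) at_top sequentially"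
    using filterlim_compose[OF filterlim_real_sequentially N] .
  have inv: "(\<lambda>n. 1 / real (N n)) \<longlonglongrightarrow> 0"
    using tendsto_inverse_0_at_top[OF N'] by (simp add: inverse_eq_divide)
  {
    assume "\<And>n. k n (Y n) = k n (Z n)"
    then have "\<bar>d n\<bar> \<le> 1 / real (N n)" for n using d[of n] by simp
    then have "d \<longlonglongrightarrow> 0"
      by (rule_tac tendsto_rabs_zero_cancel, rule_tac tendsto_sandwich[OF _ _ tendsto_const inv]) auto
    from tendsto_exp[OF this] show "(\<lambda>n. real (Y n) / real (Z n)) \<longlonglongrightarrow> 1"
      by (simp add: ratio)
  next
    assume lt: "\<And>n. k n (Y n) < k n (Z n)"
    have "- 1 + real (N n) \<le> - d n" for n
    proof -
      have "real_of_int (k n (Y n) - k n (Z n)) \<le> real_of_int (- 1)"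
        using lt[of n] by (subst of_int_le_iff) simp
      then have "real (N n) * (k n (Y n) - k n (Z n)) \<le> real (N n) * (- 1)"
        by (intro mult_left_mono) auto
      moreover have "1 / real (N n) \<le> 1" using pos(3)[of n] by simp
      ultimately show ?thesis using d[of n] by linarith
    qed
    then have "filterlim (\<lambda>n. - d n) at_top sequentially"
      using filterlim_tendsto_add_at_top[OF tendsto_const[of "- 1"] N']
      by (rule_tac filterlim_at_top_mono) auto
    then have "filterlim d at_bot sequentially"
      by (simp add: filterlim_uminus_at_bot)
    then show "(\<lambda>n. real (Y n) / real (Z n)) \<longlonglongrightarrow> 0"
      unfolding ratio by (rule filterlim_compose[OF exp_at_bot])
  }
qed

text \<open>In a level-coloured image, entries are either almost equal or differ by a huge factor; \<open>\<kappa>\<close> ranks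
  them by size. Normalising by the entries of rank \<open>g\<close> and letting \<open>n\<close> grow, the rows of rank at most \<open>g\<close>
  map nonnegative vectors arbitrarily close to the indicator of rank \<open>g\<close>; as the cone they span is
  closed and rational, this indicator is attained. Index \<open>0\<close> is a spare coordinate that later makes
  all entries of the preimage positive.\<close>

lemma image_partition_regular_levels:
  assumes "image_partition_regular D"
  defines "u \<equiv> dim_row D" and "v \<equiv> dim_col D"
  obtains \<kappa> :: "nat \<Rightarrow> nat" and w :: "nat \<Rightarrow> nat \<Rightarrow> rat" where
    "\<And>i. i < u \<Longrightarrow> 0 < \<kappa> i \<and> \<kappa> i \<le> u"
    "\<And>g j. 0 \<le> w g j" "\<And>j. w 0 j = 1"
    "\<And>i g. i < u \<Longrightarrow> \<kappa> i \<le> g \<Longrightarrow>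
       (\<Sum>j<v. D $$ (i, j) * w g j) = (if \<kappa> i = g then 1 else 0)"
proof -
  define ok where "ok n X Y \<longleftrightarrow> (\<forall>i<u. 0 < Y i \<and> of_nat (Y i) = (\<Sum>j<v. D $$ (i, j) * of_nat (X j)))
      \<and> (\<forall>i<u. \<forall>i'<u. level_colour n (Y i) = level_colour n (Y i'))"
    for n and X Y :: "nat \<Rightarrow> nat"
  have "\<exists>X Y. ok n X Y" for n
  proof -
    obtain x c where x: "x \<in> carrier_vec v"
      "\<forall>i<u. \<exists>y>0. (D *\<^sub>v map_vec of_nat x) $ i = of_nat y \<and> level_colour n y = c"
      using assms(1) finite_level_colour[of n "{0<..}"]
      unfolding image_partition_regular_def u_def v_def by blast
    then obtain Y where Y: "\<forall>i<u. Y i > 0 \<and> (D *\<^sub>v map_vec of_nat x) $ i = of_nat (Y i)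
        \<and> level_colour n (Y i) = c" by metis
    have "(D *\<^sub>v map_vec of_nat x) $ i = (\<Sum>j<v. D $$ (i, j) * of_nat (x $ j))" if "i < u" for i
      using x(1) that unfolding u_def v_def
      by (auto simp: scalar_prod_def lessThan_atLeast0 intro!: sum.cong)
    then show ?thesis
      using Y by (intro exI[of _ "\<lambda>j. x $ j"] exI[of _ Y]) (auto simp: ok_def)
  qed
  then obtain X Y where "ok n (X n) (Y n)" for n
    by metis
  then have Y_pos: "\<And>n i. i < u \<Longrightarrow> 0 < Y n i"
    and Y_eq: "\<And>n i. i < u \<Longrightarrow> of_nat (Y n i) = (\<Sum>j<v. D $$ (i, j) * of_nat (X n j))"
    and Y_col: "\<And>n i i'. i < u \<Longrightarrow> i' < u \<Longrightarrow> level_colour n (Y n i) = level_colour n (Y n i')"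
    unfolding ok_def by blast+
  define k where "k n i = \<lfloor>ln (real (Y n i)) / real n\<rfloor>" for n i
  \<comment> \<open>Rank by the number of entries on strictly lower levels. \<open>Suc\<close> keeps
    0 free as the spare rank, and \<open>restrict\<close> puts \<open>rk n\<close> into a finite
    function space.\<close>
  define rk where "rk n = restrict (\<lambda>i. Suc (card {j. j < u \<and> k n j < k n i})) {..<u}" for n
  have rk_le: "rk n i \<le> u" if "i < u" for n i
  proof -
    have "card {j. j < u \<and> k n j < k n i} \<le> card ({..<u} - {i})"
      by (intro card_mono) auto
    then show ?thesis using that by (simp add: rk_def)
  qed
  have rk_mono: "rk n i < rk n i'" if "k n i < k n i'" "i < u" "i' < u" for n i i'
  proof -
    have "card {j. j < u \<and> k n j < k n i} < card {j. j < u \<and> k n j < k n i'}"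
      using that by (intro psubset_card_mono) auto
    then show ?thesis using that by (simp add: rk_def)
  qed
  have rk_less: "k n i < k n i'" if "rk n i < rk n i'" "i < u" "i' < u" for n i i'
  proof (rule ccontr)
    assume "\<not> ?thesis"
    then have "k n i' \<le> k n i" by simp
    then have "k n i' < k n i \<or> k n i' = k n i" by linarith
    then have "rk n i' \<le> rk n i"
      using rk_mono[of n i' i] that by (auto simp: rk_def)
    then show False using that by simp
  qed
  have rk_eq: "k n i = k n i'" if "rk n i = rk n i'" "i < u" "i' < u" for n i i'
    using rk_mono[of n i i'] rk_mono[of n i' i] that by (metis linorder_neqE_linordered_idom less_irrefl)
  have "rk ` {0<..} \<subseteq> PiE {..<u} (\<lambda>_. {..u})"
    by (intro image_subsetI PiE_I) (simp_all add: rk_le, simp add: rk_def)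
  then have "finite (rk ` {0<..})"
    by (rule finite_subset) (simp add: finite_PiE)
  \<comment> \<open>Infinitely many \<open>n\<close> share one ranking; the limits are taken along
    these.\<close>
  from pigeonhole_infinite[OF infinite_Ioi this]
  obtain n0 where "infinite {n \<in> {0<..}. rk n = rk n0}" by auto
  then obtain N :: "nat \<Rightarrow> nat" where N: "strict_mono N" "\<And>n. N n > 0 \<and> rk (N n) = rk n0"
    using infinite_enumerate[of "{n \<in> {0<..}. rk n = rk n0}"] by auto
  define \<kappa> where "\<kappa> = rk n0"
  have lim: "(\<lambda>n. real (Y (N n) i) / real (Y (N n) i')) \<longlonglongrightarrow> (if \<kappa> i = \<kappa> i' then 1 else 0)"
    if "i < u" "i' < u" "\<kappa> i \<le> \<kappa> i'" for i i'
  proof -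
    have Nlim: "filterlim N at_top at_top"
      using N(1) by (rule filterlim_subseq)
    have Npos: "N n > 0" for n using N(2) by simp
    have col: "level_colour (N n) (Y (N n) i) = level_colour (N n) (Y (N n) i')" for n
      using that by (intro Y_col)
    note ratio = ln_level_ratio_tendsto[of "\<lambda>n. Y (N n) i" "\<lambda>n. Y (N n) i'" N,
        OF Y_pos[OF that(1)] Y_pos[OF that(2)] Npos Nlim col]
    show ?thesis
    proof (cases "\<kappa> i = \<kappa> i'")
      case True
      then have "k (N n) i = k (N n) i'" for n
        using that N(2)[of n] by (intro rk_eq) (auto simp: \<kappa>_def)
      then show ?thesis
        using ratio(1) True by (simp add: k_def)
    next
      case False
      then have "k (N n) i < k (N n) i'" for n
        using that N(2)[of n] by (intro rk_less) (auto simp: \<kappa>_def)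
      then show ?thesis
        using ratio(2) False by (simp add: k_def)
    qed
  qed
  define good where "good g w \<longleftrightarrow> (\<forall>j. 0 \<le> w j) \<and> (g = 0 \<longrightarrow> (\<forall>j. w j = 1)) \<and>
      (\<forall>i<u. \<kappa> i \<le> g \<longrightarrow> (\<Sum>j<v. D $$ (i, j) * w j) = (if \<kappa> i = g then 1 else 0))"
    for g and w :: "nat \<Rightarrow> rat"
  have "\<exists>w. good g w" for g
  proof (cases "\<exists>i0<u. \<kappa> i0 = g")
    case False
    \<comment> \<open>No row has rank \<open>g\<close>: the zero vector serves, except at the spare
      rank 0, where no row imposes a condition and the constant 1 is chosen.\<close>
    have "0 < \<kappa> i" if "i < u" for i using that by (simp add: \<kappa>_def rk_def)
    then show ?thesis
      using False by (intro exI[of _ "\<lambda>_. if g = 0 then 1 else 0"]) (auto simp: good_def)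
  next
    case True
    then obtain i0 where i0: "i0 < u" "\<kappa> i0 = g" by auto
    define I where "I = {i. i < u \<and> \<kappa> i \<le> g}"
    define b :: "nat \<Rightarrow> rat" where "b i = (if \<kappa> i = g then 1 else 0)" for i
    \<comment> \<open>Farkas for the columns of \<open>D\<close> on the rows of rank at most
      \<open>g\<close>: a functional \<open>c\<close> nonpositive on the columns is nonpositive on
      every image \<open>Y n\<close> and, after dividing by \<open>Y n i0\<close> and passing to the
      limit, on \<open>b\<close>.\<close>
    have "\<exists>l. (\<forall>j\<in>{..<v}. 0 \<le> l j) \<and> (\<forall>i\<in>I. b i = (\<Sum>j<v. l j * D $$ (i, j)))"
    proof (rule farkas)
      fix c :: "nat \<Rightarrow> rat" assume c: "\<And>j. j \<in> {..<v} \<Longrightarrow> (\<Sum>i\<in>I. c i * D $$ (i, j)) \<le> 0"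
      have "(\<Sum>i\<in>I. of_rat (c i) * (real (Y n i) / real (Y n i0))) \<le> 0" for n
      proof -
        have "(\<Sum>i\<in>I. c i * of_nat (Y n i)) = (\<Sum>i\<in>I. \<Sum>j<v. c i * (D $$ (i, j) * of_nat (X n j)))"
          by (intro sum.cong) (auto simp: Y_eq I_def sum_distrib_left)
        also have "\<dots> = (\<Sum>j<v. of_nat (X n j) * (\<Sum>i\<in>I. c i * D $$ (i, j)))"
          by (subst sum.swap) (simp add: sum_distrib_left mult_ac)
        also have "\<dots> \<le> 0"
          using c by (intro sum_nonpos) (auto intro!: mult_nonneg_nonpos)
        finally have "real_of_rat (\<Sum>i\<in>I. c i * of_nat (Y n i)) \<le> 0" by simp
        then have "(\<Sum>i\<in>I. of_rat (c i) * real (Y n i)) \<le> 0"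
          by (simp add: of_rat_sum of_rat_mult)
        then show ?thesis
          using divide_nonpos_nonneg[of "\<Sum>i\<in>I. of_rat (c i) * real (Y n i)" "real (Y n i0)"]
          by (simp add: sum_divide_distrib)
      qed
      moreover have "(\<lambda>n. \<Sum>i\<in>I. of_rat (c i) * (real (Y (N n) i) / real (Y (N n) i0)))
          \<longlonglongrightarrow> (\<Sum>i\<in>I. of_rat (c i) * of_rat (b i))"
      proof (intro tendsto_sum tendsto_mult tendsto_const)
        fix i assume "i \<in> I"
        then show "(\<lambda>n. real (Y (N n) i) / real (Y (N n) i0)) \<longlonglongrightarrow> of_rat (b i)"
          using lim[of i i0] i0 by (auto simp: I_def b_def)
      qed
      ultimately have "(\<Sum>i\<in>I. real_of_rat (c i) * of_rat (b i)) \<le> 0"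
        by (intro LIMSEQ_le_const2) auto
      then have "real_of_rat (\<Sum>i\<in>I. c i * b i) \<le> 0"
        by (simp add: of_rat_sum of_rat_mult)
      then show "(\<Sum>i\<in>I. c i * b i) \<le> 0" by simp
    qed (auto simp: I_def)
    then obtain l where l: "\<And>j. j < v \<Longrightarrow> 0 \<le> l j" "\<And>i. i \<in> I \<Longrightarrow> b i = (\<Sum>j<v. l j * D $$ (i, j))"
      by auto
    have "g \<noteq> 0" using i0 by (auto simp: \<kappa>_def rk_def)
    moreover have "(\<Sum>j<v. D $$ (i, j) * (if j < v then l j else 0)) = b i" if "i \<in> I" for i
      unfolding l(2)[OF that] by (intro sum.cong) auto
    ultimately show ?thesis
      using l(1) by (intro exI[of _ "\<lambda>j. if j < v then l j else 0"]) (auto simp: I_def b_def good_def)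
  qed
  then obtain w where w: "good g (w g)" for g by metis
  show ?thesis
  proof (rule that[of \<kappa> w])
    show "0 < \<kappa> i \<and> \<kappa> i \<le> u" if "i < u" for i
      using that rk_le[of i n0] by (simp add: \<kappa>_def rk_def)
    show "0 \<le> w g j" "w 0 j = 1" for g j
      using w by (simp_all add: good_def)
    show "(\<Sum>j<v. D $$ (i, j) * w g j) = (if \<kappa> i = g then 1 else 0)" if "i < u" "\<kappa> i \<le> g" for i g
      using w[of g] that unfolding good_def by blast
  qed
qed

section \<open>Ultrafilters near zero\<close>

text \<open>Translates back to families of subsets of \<open>S\<close>. On \<open>O_plus S\<close>
  the inverse sends \<open>p\<close> to \<open>\<lambda>B. B \<inter> S \<in> p\<close>, and
  \<open>near_zero\<close> is the counterpart of \<open>O_plus\<close>.\<close>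

definition trace :: "'a set \<Rightarrow> ('a set \<Rightarrow> bool) \<Rightarrow> 'a set set" where
  "trace S P = {B. B \<subseteq> S \<and> P B}"

definition near_zero :: "real set \<Rightarrow> (real set \<Rightarrow> bool) \<Rightarrow> bool" where
  "near_zero S P \<longleftrightarrow> ultra P \<and> (\<forall>\<epsilon>>0. P ({0<..<\<epsilon>} \<inter> S))"

lemma near_zeroD:
  assumes "near_zero S P"
  shows "ultra P" "\<epsilon> > 0 \<Longrightarrow> P ({0<..<\<epsilon>} \<inter> S)" "P S"
proof -
  show P: "ultra P" "\<epsilon> > 0 \<Longrightarrow> P ({0<..<\<epsilon>} \<inter> S)" for \<epsilon>
    using assms by (auto simp: near_zero_def)
  show "P S" by (rule ultra_mono[OF P(1) P(2)[of 1]]) auto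
qed

lemma ultra_Int_large: "ultra P \<Longrightarrow> P S \<Longrightarrow> P (A \<inter> S) \<longleftrightarrow> P A"
  by (simp add: ultra_Int)

lemma compact_near_zero: "compact {P. near_zero S P}"
proof -
  have "closed {P. near_zero S P}"
    unfolding near_zero_def imp_conv_disj
    by (intro closed_Collect_conj closed_Collect_all closed_Collect_disj closed_Collect_const
        closed_ultra closed_holds)
  from compact_Int_closed[OF compact_bool_functions this] show ?thesis by simp
qed

lemma near_zero_uadd:
  assumes S: "\<And>x y. x \<in> S \<Longrightarrow> y \<in> S \<Longrightarrow> x + y \<in> S"
    and P: "near_zero S P" and Q: "near_zero S Q"
  shows "near_zero S (uadd P Q)"
  unfolding near_zero_def
proof (intro conjI allI impI)
  note P = near_zeroD[OF P] and Q = near_zeroD[OF Q]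
  show "ultra (uadd P Q)" using P Q by (intro ultra_uadd)
  fix \<epsilon> :: real assume "\<epsilon> > 0"
  then have half: "\<epsilon> / 2 > 0" by simp
  have "{0<..<\<epsilon> / 2} \<inter> S \<subseteq> {x. Q {y. x + y \<in> {0<..<\<epsilon>} \<inter> S}}"
  proof
    fix x assume x: "x \<in> {0<..<\<epsilon> / 2} \<inter> S"
    have "{0<..<\<epsilon> / 2} \<inter> S \<subseteq> {y. x + y \<in> {0<..<\<epsilon>} \<inter> S}"
      using x S by auto
    then show "x \<in> {x. Q {y. x + y \<in> {0<..<\<epsilon>} \<inter> S}}"
      using ultra_mono[OF Q(1) Q(2)[OF half]] by simp
  qed
  then show "uadd P Q ({0<..<\<epsilon>} \<inter> S)"
    unfolding uadd_def by (rule ultra_mono[OF P(1) P(2)[OF half]])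
qed

section \<open>Correspondence with ultrafilters given as families of sets\<close>

lemma trace_ultrafilters:
  assumes "ultra P" "P S"
  shows "trace S P \<in> ultrafilters S"
proof -
  have "P (S - A)" if "\<not> P A" for A
    using that assms by (simp add: Diff_eq ultra_Int ultra_Compl)
  then show ?thesis
    using assms ultra_empty[OF assms(1)] ultra_mono[OF assms(1)]
    by (auto simp: ultrafilters_def trace_def ultra_Int)
qed

lemma trace_O_plus: "near_zero S P \<Longrightarrow> trace S P \<in> O_plus S"
  using trace_ultrafilters near_zeroD[of S P] by (auto simp: O_plus_def trace_def)

lemma near_zero_of_O_plus:
  assumes "p \<in> O_plus S"
  shows "near_zero S (\<lambda>B. B \<inter> S \<in> p)" "trace S (\<lambda>B. B \<inter> S \<in> p) = p"
proof -
  have p: "p \<subseteq> Pow S" "S \<in> p" "{} \<notin> p" "\<And>A B. A \<in> p \<Longrightarrow> B \<in> p \<Longrightarrow> A \<inter> B \<in> p"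
    "\<And>A B. A \<in> p \<Longrightarrow> A \<subseteq> B \<Longrightarrow> B \<subseteq> S \<Longrightarrow> B \<in> p"
    "\<And>A. A \<subseteq> S \<Longrightarrow> A \<in> p \<or> S - A \<in> p"
    and eps: "\<And>\<epsilon>. \<epsilon> > 0 \<Longrightarrow> {0<..<\<epsilon>} \<inter> S \<in> p"
    using assms unfolding O_plus_def ultrafilters_def by auto
  have "A \<inter> B \<inter> S \<in> p \<longleftrightarrow> A \<inter> S \<in> p \<and> B \<inter> S \<in> p" for A B
  proof
    assume "A \<inter> B \<inter> S \<in> p"
    then show "A \<inter> S \<in> p \<and> B \<inter> S \<in> p" using p(5) by (metis Int_lower1 Int_lower2 inf_mono order_refl)
  next
    assume "A \<inter> S \<in> p \<and> B \<inter> S \<in> p"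
    then have "(A \<inter> S) \<inter> (B \<inter> S) \<in> p" using p(4) by blast
    moreover have "(A \<inter> S) \<inter> (B \<inter> S) = A \<inter> B \<inter> S" by auto
    ultimately show "A \<inter> B \<inter> S \<in> p" by simp
  qed
  moreover have "- A \<inter> S \<in> p \<longleftrightarrow> A \<inter> S \<notin> p" for A
  proof -
    have eq: "S - A \<inter> S = - A \<inter> S" by auto
    have "(A \<inter> S) \<inter> (- A \<inter> S) = {}" by auto
    then show ?thesis
      using p(4)[of "A \<inter> S" "- A \<inter> S"] p(3) p(6)[of "A \<inter> S"] eq by auto
  qed
  ultimately show "near_zero S (\<lambda>B. B \<inter> S \<in> p)"
    using eps by (auto simp: near_zero_def ultra_def Int_assoc)
  show "trace S (\<lambda>B. B \<inter> S \<in> p) = p"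
    using p(1) by (auto simp: trace_def Int_absorb2)
qed

lemma trace_inverse: "near_zero S P \<Longrightarrow> (\<lambda>B. B \<inter> S \<in> trace S P) = P"
  using near_zeroD[of S P] by (auto simp: trace_def fun_eq_iff ultra_Int_large)

lemma trace_uadd:
  assumes "near_zero S P" "near_zero S Q"
  shows "trace S (uadd P Q) = uf_add S (trace S P) (trace S Q)"
proof -
  note P = near_zeroD[OF assms(1)] and Q = near_zeroD[OF assms(2)]
  have "Q {y \<in> S. x + y \<in> B} \<longleftrightarrow> Q {y. x + y \<in> B}" for x B
    using ultra_Int_large[OF Q(1,3), of "{y. x + y \<in> B}"] by (simp add: Int_def conj_commute)
  moreover have "P {x \<in> S. A x} \<longleftrightarrow> P {x. A x}" for A
    using ultra_Int_large[OF P(1,3), of "{x. A x}"] by (simp add: Int_def conj_commute)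
  ultimately show ?thesis
    by (auto simp: trace_def uf_add_def uadd_def shift_back_def)
qed

lemma near_zero_exists:
  assumes "\<And>\<epsilon>. \<epsilon> > 0 \<Longrightarrow> {0<..<\<epsilon>} \<inter> S \<noteq> {}"
  shows "{P. near_zero S P} \<noteq> {}"
proof -
  have "compact {P :: real set \<Rightarrow> bool. ultra P}"
    using compact_Int_closed[OF compact_bool_functions closed_ultra] by simp
  then have "{P. ultra P} \<inter> (\<Inter>\<epsilon>\<in>{0<..}. {P. P ({0<..<\<epsilon>} \<inter> S)}) \<noteq> {}"
  proof (rule compact_imp_fip_image)
    fix E :: "real set" assume E: "finite E" "E \<subseteq> {0<..}"
    \<comment> \<open>Finitely many bounds are met by a principal ultrafilter at one small point; 1
      keeps the minimum defined when \<open>E\<close> is empty.\<close>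
    have "Min (insert 1 E) > 0" using E by (subst Min_gr_iff) auto
    then obtain s where s: "s \<in> {0<..<Min (insert 1 E)} \<inter> S" using assms by blast
    have "(\<lambda>B. s \<in> B) \<in> {P. ultra P} \<inter> (\<Inter>\<epsilon>\<in>E. {P. P ({0<..<\<epsilon>} \<inter> S)})"
      using s E by (auto simp: ultra_def)
    then show "{P. ultra P} \<inter> (\<Inter>\<epsilon>\<in>E. {P. P ({0<..<\<epsilon>} \<inter> S)}) \<noteq> {}" by blast
  qed (rule closed_holds)
  then show ?thesis by (auto simp: near_zero_def)
qed

text \<open>The density hypothesis matters: if \<open>O_plus S\<close> were empty there would be no ideal, and the
  intersection \<open>K_O_plus S\<close> would degenerate to \<open>UNIV\<close>.\<close>

lemma K_O_plus_minimal_idempotent: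
  assumes S: "\<And>x y. x \<in> S \<Longrightarrow> y \<in> S \<Longrightarrow> x + y \<in> S"
    and dense: "\<And>\<epsilon>. \<epsilon> > 0 \<Longrightarrow> {0<..<\<epsilon>} \<inter> S \<noteq> {}"
    and p: "p \<in> K_O_plus S" "uf_add S p p = p"
  defines "P \<equiv> \<lambda>B. B \<inter> S \<in> p"
  shows "near_zero S P" "uadd P P = P" "trace S P = p"
    and "\<And>F. near_zero S F \<Longrightarrow> uadd F F = F \<Longrightarrow> uadd F P = F \<Longrightarrow> uadd P F = F \<Longrightarrow> F = P"
proof -
  define X where "X = {P. near_zero S P}"
  have mul: "uadd P Q \<in> X" if "P \<in> X" "Q \<in> X" for P Q
    using near_zero_uadd[OF S] that by (auto simp: X_def)
  have "compact X" "X \<noteq> {}"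
    using compact_near_zero near_zero_exists[OF dense] by (auto simp: X_def)
  then obtain L where L: "uadd.minimal_left_ideal X L"
    using uadd.minimal_left_ideal_exists mul by blast
  then have L_ideal: "L \<noteq> {}" "L \<subseteq> X" "\<And>P Q. P \<in> X \<Longrightarrow> Q \<in> L \<Longrightarrow> uadd P Q \<in> L"
    by (auto simp: uadd.minimal_left_ideal_def uadd.left_ideal_def)
  \<comment> \<open>\<open>I\<close> is \<open>L + X\<close>, a two-sided ideal because
    \<open>L\<close> is a left ideal and \<open>X\<close> is closed under addition. It contains
    \<open>K_O_plus S\<close>, so \<open>p\<close> comes from a sum \<open>Q + T\<close> with
    \<open>Q\<close> in \<open>L\<close>.\<close>
  define I where "I = {trace S (uadd Q R) | Q R. Q \<in> L \<and> R \<in> X}"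
  have "O_plus_ideal S I"
    unfolding O_plus_ideal_def
  proof (intro conjI ballI)
    show "I \<noteq> {}" using L_ideal \<open>X \<noteq> {}\<close> by (auto simp: I_def)
    show "I \<subseteq> O_plus S"
      using L_ideal mul by (auto simp: I_def X_def intro!: trace_O_plus)
    fix r q assume r: "r \<in> O_plus S" and q: "q \<in> I"
    define R where "R = (\<lambda>B. B \<inter> S \<in> r)"
    have R: "R \<in> X" "trace S R = r"
      using near_zero_of_O_plus[OF r] by (simp_all add: X_def R_def)
    obtain Q T where QT: "Q \<in> L" "T \<in> X" "q = trace S (uadd Q T)"
      using q by (auto simp: I_def)
    have "Q \<in> X" using QT L_ideal by auto
    have "uf_add S r q = trace S (uadd (uadd R Q) T)"
      using R QT mul[OF \<open>Q \<in> X\<close> QT(2)] trace_uadd[of S R "uadd Q T"] by (simp add: X_def uadd.assoc)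
    then show "uf_add S r q \<in> I"
      using L_ideal(3)[OF R(1) QT(1)] QT(2) by (auto simp: I_def)
    have "uf_add S q r = trace S (uadd Q (uadd T R))"
      using R QT mul[OF \<open>Q \<in> X\<close> QT(2)] trace_uadd[of S "uadd Q T" R] by (simp add: X_def uadd.assoc)
    then show "uf_add S q r \<in> I"
      using mul[OF QT(2) R(1)] QT(1) by (auto simp: I_def)
  qed
  then have "p \<in> I" using p(1) by (auto simp: K_O_plus_def)
  then obtain Q T where QT: "Q \<in> L" "T \<in> X" "p = trace S (uadd Q T)"
    by (auto simp: I_def)
  have "uadd Q T \<in> X" using QT L_ideal mul by blast
  then have P_eq: "P = uadd Q T"
    using trace_inverse[of S "uadd Q T"] QT(3) by (simp add: P_def X_def)
  then have "P \<in> X" using \<open>uadd Q T \<in> X\<close> by simp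
  then show nz: "near_zero S P" by (simp add: X_def)
  show tr: "trace S P = p" using P_eq QT by simp
  have "trace S (uadd P P) = p"
    using trace_uadd[OF nz nz] p(2) tr by simp
  then show "uadd P P = P"
    using trace_inverse[OF near_zero_uadd[OF S nz nz]] by (simp add: P_def)
  fix F assume F: "near_zero S F" "uadd F F = F" "uadd F P = F" "uadd P F = F"
  show "F = P"
  proof (rule uadd.minimal_left_ideal_idempotent_minimal)
    \<comment> \<open>The translate of \<open>L\<close> by \<open>T\<close> is again a minimal left
      ideal, and it contains \<open>P\<close>.\<close>
    show "uadd.minimal_left_ideal X ((\<lambda>x. uadd x T) ` L)"
      by (rule uadd.minimal_left_ideal_translate[OF L QT(2) mul])
  qed (use F QT P_eq mul in \<open>auto simp: X_def\<close>)
qed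

section \<open>Ultrafilters whose images under first entries rows agree\<close>

text \<open>A row of a first entries matrix read in reversed order: its first entry is the 1 at
  \<open>k\<close>, and the remaining coefficients sit at smaller indices.\<close>

definition first_entry_row :: "nat \<Rightarrow> (nat \<Rightarrow> rat) \<Rightarrow> (nat \<Rightarrow> real) \<Rightarrow> real" where
  "first_entry_row k l y = y k + (\<Sum>g<k. of_rat (l g) * y g)"

lemma first_entry_row_add: "first_entry_row k l (x + y) = first_entry_row k l x + first_entry_row k l y"
  by (simp add: first_entry_row_def algebra_simps sum.distrib)

lemma semigroup_of_nat_mult:
  fixes S :: "real set"
  assumes "\<And>x y. x \<in> S \<Longrightarrow> y \<in> S \<Longrightarrow> x + y \<in> S" "s \<in> S" "0 < n"
  shows "of_nat n * s \<in> S"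
  using \<open>0 < n\<close>
proof (induction n rule: nat_induct_non_zero)
  case (Suc n)
  then show ?case using assms(1)[of "of_nat n * s" s] assms(2) by (simp add: algebra_simps)
qed (use assms in auto)

lemma semigroup_sum:
  assumes "\<And>x y. x \<in> S \<Longrightarrow> y \<in> S \<Longrightarrow> x + y \<in> S" "finite I" "I \<noteq> {}" "\<And>i. i \<in> I \<Longrightarrow> f i \<in> S"
  shows "sum f I \<in> (S :: real set)"
  using assms(2-4) by (induction I rule: finite_ne_induct) (auto intro: assms(1))

context
  fixes S :: "real set" and P :: "real set \<Rightarrow> bool"
  assumes S_pos: "S \<subseteq> {0<..}"
    and S_add: "\<And>x y. x \<in> S \<Longrightarrow> y \<in> S \<Longrightarrow> x + y \<in> S"
    and P: "near_zero S P" "uadd P P = P"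
    and P_min: "\<And>F. near_zero S F \<Longrightarrow> uadd F F = F \<Longrightarrow> uadd F P = F \<Longrightarrow> uadd P F = F \<Longrightarrow> F = P"
    and P_dil: "\<And>c::nat. 0 < c \<Longrightarrow> P ((\<lambda>s. of_nat c * s) ` S)"
begin

text \<open>The dilation hypothesis enters here. For \<open>r = m / n\<close> and small
  \<open>s = n t\<close> with \<open>t\<close> in \<open>S\<close>, the product
  \<open>r s = m t\<close> lies in \<open>S\<close>, and such \<open>s\<close> form a large
  set.\<close>

lemma rat_dilation_large:
  assumes "0 < r" "0 < \<epsilon>"
  shows "P {s. of_rat r * s \<in> {0<..<\<epsilon>} \<inter> S}"
proof -
  obtain a b where ab: "quotient_of r = (a, b)" by fastforce
  have "b > 0" using quotient_of_denom_pos[OF ab] .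
  have r: "r = of_int a / of_int b" by (rule quotient_of_div[OF ab])
  then have "a > 0" using \<open>0 < r\<close> \<open>b > 0\<close> by (simp add: zero_less_divide_iff)
  define m n where "m = nat a" and "n = nat b"
  have mn: "0 < m" "0 < n" "real_of_rat r = of_nat m / of_nat n"
    using \<open>a > 0\<close> \<open>b > 0\<close> by (simp_all add: m_def n_def r of_rat_divide)
  have "real_of_rat r > 0" using \<open>0 < r\<close> by simp
  have "P ((\<lambda>s. of_nat n * s) ` S \<inter> ({0<..<\<epsilon> / of_rat r} \<inter> S))"
    using ultra_Int[OF near_zeroD(1)[OF P(1)]] P_dil[OF mn(2)]
      near_zeroD(2)[OF P(1), of "\<epsilon> / of_rat r"] assms by simp
  then show ?thesis
  proof (rule ultra_mono[OF near_zeroD(1)[OF P(1)]], intro subsetI)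
    fix s assume s: "s \<in> (\<lambda>s. of_nat n * s) ` S \<inter> ({0<..<\<epsilon> / of_rat r} \<inter> S)"
    then obtain t where t: "t \<in> S" "s = of_nat n * t" by auto
    have "of_rat r * s = of_nat m * t" using mn t by simp
    also have "\<dots> \<in> S" using semigroup_of_nat_mult[OF S_add t(1) mn(1)] .
    finally show "s \<in> {s. of_rat r * s \<in> {0<..<\<epsilon>} \<inter> S}"
      using s \<open>real_of_rat r > 0\<close> by (auto simp: field_simps)
  qed
qed

text \<open>The new coordinate is a large multiple \<open>M\<close> of the sum of the old ones,
  making every coefficient \<open>M + l g\<close> positive. For almost all vectors the row value is
  then a sum of \<open>m\<close> members of \<open>S\<close>, each below
  \<open>\<epsilon> / m\<close>.\<close>

lemma first_entries_lift:
  assumes q: "ultra q" "\<And>g. g < m \<Longrightarrow> push (\<lambda>y. y g) q = P"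
    and "0 < m" "finite \<Lambda>"
  shows "\<exists>M. \<forall>l\<in>\<Lambda>. near_zero S (push (first_entry_row m l) (push (\<lambda>y. y(m := \<Sum>g<m. of_nat M * y g)) q))"
proof -
  obtain M :: nat where "Max (insert 0 ((\<lambda>(l, g). - l g) ` (\<Lambda> \<times> {..<m}))) < of_nat M"
    using reals_Archimedean2 by blast
  then have M: "of_nat M + l g > 0" if "l \<in> \<Lambda>" "g < m" for l g
    using that \<open>finite \<Lambda>\<close> by (subst (asm) Max_less_iff) force+
  let ?h = "\<lambda>y. y(m := \<Sum>g<m. real M * y g)"
  have "near_zero S (push (first_entry_row m l) (push ?h q))" if l: "l \<in> \<Lambda>" for l
    unfolding near_zero_def
  proof (intro conjI allI impI)
    show "ultra (push (first_entry_row m l) (push ?h q))" by (intro ultra_push q)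
    fix \<epsilon> :: real assume "\<epsilon> > 0"
    have "q {y. \<forall>g\<in>{..<m}. of_rat (of_nat M + l g) * y g \<in> {0<..<\<epsilon> / m} \<inter> S}"
    proof (rule ultra_Collect_ball[OF q(1)])
      fix g assume "g \<in> {..<m}"
      then have "push (\<lambda>y. y g) q {s. of_rat (of_nat M + l g) * s \<in> {0<..<\<epsilon> / m} \<inter> S}"
        using rat_dilation_large[OF M[OF l]] q(2) \<open>\<epsilon> > 0\<close> \<open>0 < m\<close> by simp
      then show "q {y. of_rat (of_nat M + l g) * y g \<in> {0<..<\<epsilon> / m} \<inter> S}"
        by (simp add: push_def vimage_def)
    qed simp
    moreover have "first_entry_row m l (?h y) \<in> {0<..<\<epsilon>} \<inter> S"
      if y: "\<forall>g\<in>{..<m}. of_rat (of_nat M + l g) * y g \<in> {0<..<\<epsilon> / m} \<inter> S" for y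
    proof -
      let ?s = "\<Sum>g<m. of_rat (of_nat M + l g) * y g"
      have "first_entry_row m l (?h y) = ?s"
        by (simp add: first_entry_row_def of_rat_add algebra_simps sum.distrib)
      moreover have "?s \<in> S"
        using y \<open>0 < m\<close> by (intro semigroup_sum[OF S_add]) auto
      moreover have "?s < (\<Sum>g<m. \<epsilon> / m)"
        using y \<open>0 < m\<close> by (intro sum_strict_mono) auto
      ultimately show ?thesis using S_pos \<open>0 < m\<close> by auto
    qed
    ultimately show "push (first_entry_row m l) (push ?h q) ({0<..<\<epsilon>} \<inter> S)"
      unfolding push_def by (rule_tac ultra_mono[OF q(1)]) auto
  qed
  then show ?thesis by blast
qed

text \<open>The induction adds a leading coordinate \<open>m\<close>. Let \<open>T\<close> consist of the ultrafilters that already work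
  for the rows with leading coordinate below \<open>m\<close>, and let \<open>hat\<close> be \<open>P\<close> put on the coordinate \<open>m\<close> alone.
  An idempotent \<open>e\<close> of the closed left ideal \<open>T + hat\<close> gives the idempotent \<open>f = hat + e\<close> below \<open>hat\<close>.
  The images of \<open>f\<close> are idempotents below the minimal idempotent \<open>P\<close>, hence equal to \<open>P\<close>.\<close>

lemma first_entries_ultrafilter:
  assumes fin: "finite \<Lambda>" and zero: "(\<lambda>_. 0) \<in> \<Lambda>"
  shows "\<exists>q. ultra q \<and> (\<forall>k<m. \<forall>l\<in>\<Lambda>. push (first_entry_row k l) q = P)"
proof (induction m)
  case 0
  show ?case using ultra_push[OF near_zeroD(1)[OF P(1)]] by blast
next
  case (Suc m)
  then obtain q where q: "ultra q" "\<And>k l. k < m \<Longrightarrow> l \<in> \<Lambda> \<Longrightarrow> push (first_entry_row k l) q = P"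
    by blast
  note uP = near_zeroD(1)[OF P(1)]
  \<comment> \<open>At leading coordinate \<open>m\<close> only nearness to zero is demanded;
    equality with \<open>P\<close> is gained at the end from minimality.\<close>
  define T where "T = {r. ultra r \<and> (\<forall>k\<in>{..<m}. \<forall>l\<in>\<Lambda>. push (first_entry_row k l) r = P)
      \<and> (\<forall>l\<in>\<Lambda>. near_zero S (push (first_entry_row m l) r))}"
  define hat where "hat = push (\<lambda>a g. if g = m then a else (0::real)) P"
  have push_add: "push (first_entry_row k l) (uadd r s)
      = uadd (push (first_entry_row k l) r) (push (first_entry_row k l) s)" for k l r s
    by (rule push_uadd) (rule first_entry_row_add)
  have hat: "ultra hat" "uadd hat hat = hat"
  proof -
    show "ultra hat" unfolding hat_def by (rule ultra_push[OF uP])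
    have "uadd hat hat = push (\<lambda>a g. if g = m then a else 0) (uadd P P)"
      unfolding hat_def by (rule push_uadd[symmetric]) (auto simp: fun_eq_iff)
    then show "uadd hat hat = hat" by (simp add: P hat_def)
  qed
  \<comment> \<open>Rows with leading coordinate below \<open>m\<close> see \<open>hat\<close> as
    the principal ultrafilter at 0, so adding it on either side does not disturb their
    images.\<close>
  have hat_row: "push (first_entry_row k l) hat = push (\<lambda>_. 0) P" if "k < m" for k l
  proof -
    have "first_entry_row k l \<circ> (\<lambda>a g. if g = m then a else 0) = (\<lambda>_. 0)"
      using that by (auto simp: first_entry_row_def fun_eq_iff intro!: sum.neutral)
    then show ?thesis by (simp add: hat_def push_push)
  qed
  have hat_row_m: "push (first_entry_row m l) hat = P" for l
  proof -
    have "first_entry_row m l \<circ> (\<lambda>a g. if g = m then a else 0) = (\<lambda>a. a)"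
      by (auto simp: first_entry_row_def fun_eq_iff intro!: sum.neutral)
    then show ?thesis by (simp add: hat_def push_push push_id)
  qed
  have T_add: "uadd r s \<in> T" if "r \<in> T" "s \<in> T" for r s
    using that by (auto simp: T_def push_add P near_zero_uadd[OF S_add] ultra_uadd)
  have hat_left: "uadd hat r \<in> T" and hat_right: "uadd r hat \<in> T" if "r \<in> T" for r
    using that hat by (auto simp: T_def push_add P near_zero_uadd[OF S_add] ultra_uadd
        hat_row hat_row_m uadd_push_zero[OF uP])
  have "closed T"
  proof -
    have c: "continuous_on UNIV (push (first_entry_row k l))" for k l by (rule continuous_push)
    have "closed {r. near_zero S (push (first_entry_row m l) r)}" for l
      using closed_vimage[OF compact_imp_closed[OF compact_near_zero] c] by (simp add: vimage_def)
    then show ?thesis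
      unfolding T_def Ball_def imp_conv_disj
      by (intro closed_Collect_conj closed_Collect_all closed_Collect_disj closed_Collect_const
          closed_ultra closed_Collect_eq c continuous_on_const)
  qed
  then have "compact T"
    using compact_Int_closed[OF compact_bool_functions] by fastforce
  \<comment> \<open>For \<open>m = 0\<close> the ultrafilter \<open>hat\<close> itself works.
    Otherwise coordinate \<open>m\<close> is overwritten by a multiple of the sum of the lower ones,
    which lower rows do not notice.\<close>
  have "T \<noteq> {}"
  proof (cases "m = 0")
    case True
    then have "hat \<in> T" using hat hat_row_m P by (simp add: T_def)
    then show ?thesis by auto
  next
    case False
    have "first_entry_row g (\<lambda>_. 0) = (\<lambda>y. y g)" for g
      by (simp add: first_entry_row_def fun_eq_iff)
    then have "push (\<lambda>y. y g) q = P" if "g < m" for g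
      using q(2)[OF that zero] by simp
    then obtain M where M: "\<forall>l\<in>\<Lambda>. near_zero S
        (push (first_entry_row m l) (push (\<lambda>y. y(m := \<Sum>g<m. of_nat M * y g)) q))"
      using first_entries_lift[OF q(1) _ _ fin] False by blast
    have "first_entry_row k l \<circ> (\<lambda>y. y(m := \<Sum>g<m. of_nat M * y g)) = first_entry_row k l"
      if "k < m" for k l
      using that by (auto simp: first_entry_row_def fun_eq_iff)
    then have "push (\<lambda>y. y(m := \<Sum>g<m. of_nat M * y g)) q \<in> T"
      using M q by (auto simp: T_def ultra_push push_push)
    then show ?thesis by auto
  qed
  obtain e where e: "e \<in> (\<lambda>r. uadd r hat) ` T" "uadd e e = e"
  proof (rule uadd.idempotent_exists)
    show "compact ((\<lambda>r. uadd r hat) ` T)" using \<open>compact T\<close> by (rule uadd.compact_translate)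
    fix x y assume "x \<in> (\<lambda>r. uadd r hat) ` T" "y \<in> (\<lambda>r. uadd r hat) ` T"
    then obtain r s where rs: "r \<in> T" "s \<in> T" "x = uadd r hat" "y = uadd s hat" by auto
    have "uadd x y = uadd (uadd r (uadd hat s)) hat" by (simp add: rs uadd.assoc)
    then show "uadd x y \<in> (\<lambda>r. uadd r hat) ` T" using rs T_add hat_left by blast
  qed (use \<open>T \<noteq> {}\<close> in auto)
  have e_hat: "uadd e hat = e"
    using e(1) hat by (auto simp: uadd.assoc)
  define f where "f = uadd hat e"
  have "e \<in> T" using e(1) hat_right by auto
  then have "f \<in> T" unfolding f_def by (rule hat_left)
  have ff: "uadd f f = f"
    by (metis f_def e(2) e_hat uadd.assoc)
  have f_hat: "uadd f hat = f" "uadd hat f = f"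
    unfolding f_def using hat e_hat by (simp_all add: uadd.assoc flip: uadd.assoc[of hat hat e])
  have "push (first_entry_row m l) f = P" if "l \<in> \<Lambda>" for l
  proof (rule P_min)
    show "near_zero S (push (first_entry_row m l) f)" using \<open>f \<in> T\<close> that by (auto simp: T_def)
  qed (use ff f_hat hat_row_m push_add[of m l] in metis)+
  then show ?case
    using \<open>f \<in> T\<close> by (intro exI[of _ f]) (auto simp: T_def less_Suc_eq)
qed

text \<open>The solution is \<open>x = W y\<close> with the columns of \<open>W\<close> given by
  \<open>w\<close>. One vector \<open>y\<close> is drawn from a finite intersection of sets large
  for \<open>q\<close>: the rows of \<open>D W\<close> put its image into \<open>C\<close>, and the
  coordinate rows put the needed multiples into \<open>S\<close>.\<close>

lemma finite_image_in_large_set: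
  assumes D: "image_partition_regular D" and C: "P C"
  obtains x where "\<And>j. j < dim_col D \<Longrightarrow> x j \<in> S"
    "\<And>i. i < dim_row D \<Longrightarrow> (\<Sum>j<dim_col D. of_rat (D $$ (i, j)) * x j) \<in> C"
proof -
  define u v where "u = dim_row D" and "v = dim_col D"
  obtain \<kappa> :: "nat \<Rightarrow> nat" and w where \<kappa>: "\<And>i. i < u \<Longrightarrow> 0 < \<kappa> i \<and> \<kappa> i \<le> u"
    and w: "\<And>g j. 0 \<le> w g j" "\<And>j. w 0 j = 1"
    and Dw: "\<And>i g. i < u \<Longrightarrow> \<kappa> i \<le> g \<Longrightarrow> (\<Sum>j<v. D $$ (i, j) * w g j) = (if \<kappa> i = g then 1 else 0)"
    by (rule image_partition_regular_levels[OF D, folded u_def v_def]) blast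
  define l where "l i g = (\<Sum>j<v. D $$ (i, j) * w g j)" for i g
  obtain q where q: "ultra q" "\<And>k h. k < Suc u \<Longrightarrow> h \<in> insert (\<lambda>_. 0) (l ` {..<u})
      \<Longrightarrow> push (first_entry_row k h) q = P"
    using first_entries_ultrafilter[of "insert (\<lambda>_. 0) (l ` {..<u})" "Suc u"] by blast
  have row_C: "q {y. first_entry_row (\<kappa> i) (l i) y \<in> C}" if "i < u" for i
    using q(2)[of "\<kappa> i" "l i"] \<kappa>[OF that] that C by (auto simp: push_def vimage_def fun_eq_iff)
  have coord: "q {y. of_rat r * y g \<in> S}" if "g \<le> u" "0 < r" for g r
  proof -
    have "P {s. of_rat r * s \<in> S}"
      using rat_dilation_large[of r 1] that(2)
      by (rule_tac ultra_mono[OF near_zeroD(1)[OF P(1)]]) auto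
    moreover have "first_entry_row g (\<lambda>_. 0) = (\<lambda>y. y g)"
      by (simp add: first_entry_row_def fun_eq_iff)
    ultimately have "push (\<lambda>y. y g) q {s. of_rat r * s \<in> S}"
      using q(2)[of g "\<lambda>_. 0"] that(1) by simp
    then show ?thesis by (simp add: push_def vimage_def)
  qed
  have "q {y. (\<forall>i\<in>{..<u}. first_entry_row (\<kappa> i) (l i) y \<in> C)
      \<and> (\<forall>(g, j)\<in>{(g, j). g \<le> u \<and> j < v \<and> 0 < w g j}. of_rat (w g j) * y g \<in> S)}"
    unfolding ultra_Collect_conj[OF q(1)]
  proof (intro conjI ultra_Collect_ball[OF q(1)])
    show "finite {(g, j). g \<le> u \<and> j < v \<and> 0 < w g j}"
      by (rule finite_subset[of _ "{..u} \<times> {..<v}"]) auto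
  qed (use row_C coord in auto)
  then obtain y where y_C: "\<And>i. i < u \<Longrightarrow> first_entry_row (\<kappa> i) (l i) y \<in> C"
    and y_S: "\<And>g j. g \<le> u \<Longrightarrow> j < v \<Longrightarrow> 0 < w g j \<Longrightarrow> of_rat (w g j) * y g \<in> S"
    by (rule ultra_witness[OF q(1)]) auto
  define x where "x j = (\<Sum>g\<le>u. of_rat (w g j) * y g)" for j
  show ?thesis
  proof (rule that[of x])
    fix j assume "j < dim_col D"
    then have j: "j < v" by (simp add: v_def)
    \<comment> \<open>Zero weights are dropped to leave a sum of members of \<open>S\<close>; level
      0, of weight 1, keeps it nonempty.\<close>
    have "x j = (\<Sum>g | g \<le> u \<and> 0 < w g j. of_rat (w g j) * y g)"
      unfolding x_def using w(1) by (intro sum.mono_neutral_right) (auto simp: order.order_iff_strict)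
    also have "\<dots> \<in> S"
      using y_S j w(2)[of j] by (intro semigroup_sum[OF S_add]) (auto intro!: exI[of _ 0])
    finally show "x j \<in> S" .
  next
    fix i assume "i < dim_row D"
    then have i: "i < u" by (simp add: u_def)
    have "(\<Sum>j<v. of_rat (D $$ (i, j)) * x j)
        = (\<Sum>g\<le>u. \<Sum>j<v. of_rat (D $$ (i, j)) * (of_rat (w g j) * y g))"
      unfolding x_def sum_distrib_left by (rule sum.swap)
    also have "\<dots> = (\<Sum>g\<le>u. of_rat (l i g) * y g)"
      by (simp add: l_def of_rat_sum of_rat_mult sum_distrib_left mult_ac)
    \<comment> \<open>Levels above the rank of row \<open>i\<close> have coefficient 0, and at the
      rank itself the coefficient is 1.\<close>
    also have "\<dots> = (\<Sum>g\<le>\<kappa> i. of_rat (l i g) * y g)"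
      using \<kappa>[OF i] Dw[OF i] by (intro sum.mono_neutral_right) (auto simp: l_def not_le)
    also have "\<dots> = first_entry_row (\<kappa> i) (l i) y"
      using Dw[OF i, of "\<kappa> i"] by (simp add: first_entry_row_def l_def flip: lessThan_Suc_atMost)
    finally show "(\<Sum>j<dim_col D. of_rat (D $$ (i, j)) * x j) \<in> C"
      using y_C[OF i] by (simp add: v_def)
  qed
qed

end

section \<open>Block matrices and the conclusion\<close>

lemma inf_mat_vec_append_cols:
  assumes "finite {j. append_cols v A1 A2 i j \<noteq> 0}"
  shows "inf_mat_vec (append_cols v A1 A2) (\<lambda>j. if j < v then x j else y (j - v)) i
    = (\<Sum>j<v. of_rat (A1 i $ j) * x j) + inf_mat_vec A2 y i"
proof -
  let ?A = "append_cols v A1 A2" and ?z = "\<lambda>j. if j < v then x j else y (j - v)"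
  let ?J = "{j. A2 i j \<noteq> 0}"
  have shift: "(\<lambda>j. j + v) ` ?J = {j. ?A i j \<noteq> 0} \<inter> {v..}"
    by (force simp: append_cols_def image_iff dest: le_Suc_ex intro: exI[of _ "_ - v"])
  then have fin: "finite ?J"
    using assms finite_imageD[of "\<lambda>j. j + v" ?J] by (metis finite_Int inj_on_add')
  \<comment> \<open>The support of the row is enlarged by the zero entries among the first
    \<open>v\<close> columns, so that it splits along the blocks.\<close>
  have "inf_mat_vec ?A ?z i = (\<Sum>j\<in>{..<v} \<union> (\<lambda>j. j + v) ` ?J. of_rat (?A i j) * ?z j)"
    unfolding inf_mat_vec_def shift using assms
    by (intro sum.mono_neutral_left) (auto simp: not_less)
  also have "\<dots> = (\<Sum>j<v. of_rat (?A i j) * ?z j) + (\<Sum>j\<in>(\<lambda>j. j + v) ` ?J. of_rat (?A i j) * ?z j)"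
    using fin by (intro sum.union_disjoint) auto
  also have "(\<Sum>j\<in>(\<lambda>j. j + v) ` ?J. of_rat (?A i j) * ?z j) = inf_mat_vec A2 y i"
    unfolding inf_mat_vec_def by (subst sum.reindex) (auto simp: append_cols_def inj_on_def)
  also have "(\<Sum>j<v. of_rat (?A i j) * ?z j) = (\<Sum>j<v. of_rat (A1 i $ j) * x j)"
    by (simp add: append_cols_def)
  finally show ?thesis .
qed

theorem theorem3p4:
  fixes S :: "real set" and A :: "nat \<Rightarrow> nat \<Rightarrow> rat"
  assumes "S \<subseteq> {0<..}"
    and "\<And>x y. x \<in> S \<Longrightarrow> y \<in> S \<Longrightarrow> x + y \<in> S"
    and "{0<..} \<subseteq> closure S"
    and "\<And>c::nat. 0 < c \<Longrightarrow> central_star_near_zero S ((\<lambda>s. of_nat c * s) ` S)"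
    and "subtracted_centrally_ipr_near_zero S A"
  shows "centrally_ipr_near_zero S A"
  unfolding centrally_ipr_near_zero_def
proof (intro allI impI)
  fix C assume "central_near_zero S C"
  then obtain p where p: "p \<in> K_O_plus S" "uf_add S p p = p" and C: "C \<subseteq> S" "C \<in> p"
    by (auto simp: central_near_zero_def)
  obtain v A1 A2 D where fin: "\<And>i. finite {j. A i j \<noteq> 0}"
    and A1: "\<And>i. A1 i \<in> carrier_vec v" "\<And>i. A1 i \<in> set (rows D)"
    and A: "A = append_cols v A1 A2" and D: "image_partition_regular D"
    and A2: "centrally_ipr_near_zero S A2"
    using assms(5) unfolding subtracted_centrally_ipr_near_zero_def by blast
  have dense: "{0<..<\<epsilon>} \<inter> S \<noteq> {}" if "\<epsilon> > 0" for \<epsilon>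
  proof -
    have "\<epsilon> / 2 \<in> closure S" "\<epsilon> / 2 \<in> {0<..<\<epsilon>}" using assms(3) that by auto
    then show ?thesis
      using open_Int_closure_eq_empty[OF open_greaterThanLessThan, of 0 \<epsilon> S] by blast
  qed
  define P where "P = (\<lambda>B. B \<inter> S \<in> p)"
  note K = K_O_plus_minimal_idempotent[OF assms(2) dense p, folded P_def]
  have uP: "ultra P" "P S" using near_zeroD[OF K(1)] by auto
  have in_p: "B \<in> p \<longleftrightarrow> B \<subseteq> S \<and> P B" for B
    using K(3) by (auto simp: trace_def)
  have dil: "P ((\<lambda>s. of_nat c * s) ` S)" if "0 < c" for c :: nat
    using assms(4)[OF that] p in_p by (auto simp: central_star_near_zero_def)
  have "uadd P P C" using C in_p K(2) by simp
  then have "P {x. P {y. x + y \<in> C}}" by (simp add: uadd_def)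
  then obtain x where x: "\<And>j. j < dim_col D \<Longrightarrow> x j \<in> S"
    "\<And>i. i < dim_row D \<Longrightarrow> (\<Sum>j<dim_col D. of_rat (D $$ (i, j)) * x j) \<in> {x. P {y. x + y \<in> C}}"
    using finite_image_in_large_set[OF assms(1,2) K(1,2,4) dil D] by blast
  define a where "a i = (\<Sum>j<dim_col D. of_rat (D $$ (i, j)) * x j)" for i
  \<comment> \<open>\<open>A1\<close> has infinitely many rows, but all come from the finitely many
    rows of \<open>D\<close>, so a finite intersection suffices; meeting with \<open>S\<close> makes
    \<open>H\<close> a subset of \<open>S\<close>.\<close>
  define H where "H = {y. \<forall>i\<in>{..<dim_row D}. a i + y \<in> C} \<inter> S"
  have "P {y. \<forall>i\<in>{..<dim_row D}. a i + y \<in> C}"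
    using x(2) by (intro ultra_Collect_ball[OF uP(1)]) (auto simp: a_def)
  then have "P H" unfolding H_def by (simp add: ultra_Int uP)
  then have "central_near_zero S H"
    using p in_p by (auto simp: central_near_zero_def H_def)
  then obtain y where y: "\<And>j. y j \<in> S" "\<And>i. inf_mat_vec A2 y i \<in> H"
    using A2 unfolding centrally_ipr_near_zero_def by blast
  let ?z = "\<lambda>j. if j < v then x j else y (j - v)"
  have dim: "dim_col D = v"
    using A1[of 0] by (auto simp: rows_def dest!: carrier_vecD)
  have "?z j \<in> S" for j using x(1) y(1) by (simp add: dim)
  moreover have "inf_mat_vec A ?z i \<in> C" for i
  proof -
    obtain k where k: "k < dim_row D" "A1 i = row D k"
      using A1(2)[of i] by (auto simp: rows_def)
    have "(\<Sum>j<v. of_rat (A1 i $ j) * x j) = a k"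
      using k by (simp add: a_def dim)
    then have "inf_mat_vec A ?z i = a k + inf_mat_vec A2 y i"
      using inf_mat_vec_append_cols[of v A1 A2 i x y] fin[of i] by (simp add: A)
    then show ?thesis using y(2)[of i] k by (simp add: H_def)
  qed
  ultimately show "\<exists>x. (\<forall>j. x j \<in> S) \<and> (\<forall>i. inf_mat_vec A x i \<in> C)"
    by (intro exI[of _ ?z]) auto
qed

end
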